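(* Let $\alpha>0$ and let $n\ge 1$ be an integer. With the functions $H_{2(n+1),r}^{\alpha}$ and the recursively defined real numbers $\sigma_{k,r}^{n+1},\rho_{k,r}^{n+1}$ ($1\le k\le n+1$, $0\le r\le 2(n+1)$) given in the context, the matrix form of the linear transformation from the normalized B-basis $\{H_{2(n+1),r}^{\alpha}\}_{r=0}^{2(n+1)}$ to the canonical hyperbolic basis $\{1,\sinh(u),\cosh(u),\ldots,\sinh((n+1)u),\cosh((n+1)u)\}$ is $$ \begin{bmatrix} 1\\ \sinh(u)\\ \cosh(u)\\ \vdots\\ \sinh((n+1)u)\\ \cosh((n+1)u)\end{bmatrix} = \begin{bmatrix} 1 & 1 & \cdots & 1\\ \sigma_{1,0}^{n+1} & \sigma_{1,1}^{n+1} & \cdots & \sigma_{1,2(n+1)}^{n+1}\\ \rho_{1,0}^{n+1} & \rho_{1,1}^{n+1} & \cdots & \rho_{1,2(n+1)}^{n+1}\\ \vdots & \vdots & & \vdots\\ \sigma_{n+1,0}^{n+1} & \sigma_{n+1,1}^{n+1} & \cdots & \sigma_{n+1,2(n+1)}^{n+1}\\ \rho_{n+1,0}^{n+1} & \rho_{n+1,1}^{n+1} & \cdots & \rho_{n+1,2(n+1)}^{n+1} \end{bmatrix} \begin{bmatrix} H_{2(n+1),0}^{\alpha}(u)\\ H_{2(n+1),1}^{\alpha}(u)\\ \vdots\\ H_{2(n+1),2(n+1)}^{\alpha}(u)\end{bmatrix} $$ for all $u\in[0,\alpha]$. That is, for all $u\in[0,\alpha]$: $1=\sum_{r=0}^{2(n+1)}H_{2(n+1),r}^{\alpha}(u)$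 and, for every $k=1,\ldots,n+1$, $\sinh(ku)=\sum_{r=0}^{2(n+1)}\sigma_{k,r}^{n+1}H_{2(n+1),r}^{\alpha}(u)$ and $\cosh(ku)=\sum_{r=0}^{2(n+1)}\rho_{k,r}^{n+1}H_{2(n+1),r}^{\alpha}(u)$.
   Context: For an integer $m\ge1$ and $\alpha>0$, the normalized B-basis of order $m$ of $\operatorname{span}\{\cosh(ku),\sinh(ku):u\in[0,\alpha]\}_{k=0}^{m}$ consists of the functions $$H_{2m,i}^{\alpha}(u)=h_{2m,i}^{\alpha}\,\sinh^{2m-i}\!\left(\tfrac{\alpha-u}{2}\right)\sinh^{i}\!\left(\tfrac{u}{2}\right),\quad u\in[0,\alpha],\ i=0,1,\ldots,2m,$$ where $$h_{2m,i}^{\alpha}=\frac{1}{\sinh^{2m}(\alpha/2)}\sum_{r=0}^{\lfloor i/2\rfloor}\binom{m}{i-r}\binom{i-r}{r}\left(2\cosh(\alpha/2)\right)^{i-2r}.$$ The numbers $\sigma_{k,r}^{m},\rho_{k,r}^{m}$ ($m\ge 1$, $1\le k\le m$, $0\le r\le 2m$) are defined recursively in $m$. Initial conditions ($m=1$): $\sigma_{1,0}^{1}=0$, $\sigma_{1,1}^{1}=\tanh(\alpha/2)$, $\sigma_{1,2}^{1}=\sinh(\alpha)$; $\rho_{1,0}^{1}=\rho_{1,1}^{1}=1$, $\rho_{1,2}^{1}=\cosh(\alpha)$. Step from $m$ to $m+1$ ($m\ge1$). For $1\le r\le 2m+1$ and $j\in\{0,1,2\}$ with $0\le r-j\le 2m$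 put $\eta^{m}_{r,j}=\dfrac{h_{2m,r-j}^{\alpha}\,h_{2,j}^{\alpha}}{h_{2(m+1),r}^{\alpha}}$. Below, $\sum_j$ denotes summation over all $j\in\{0,1,2\}$ with $0\le r-j\le 2m$. (i) For $1\le k\le m$: $\sigma_{k,0}^{m+1}=\sigma_{k,0}^{m}$, $\sigma_{k,2(m+1)}^{m+1}=\sigma_{k,2m}^{m}$, and $\sigma_{k,r}^{m+1}=\sum_j \sigma_{k,r-j}^{m}\eta^m_{r,j}$ for $1\le r\le 2m+1$; likewise $\rho_{k,0}^{m+1}=\rho_{k,0}^{m}$, $\rho_{k,2(m+1)}^{m+1}=\rho_{k,2m}^{m}$, and $\rho_{k,r}^{m+1}=\sum_j \rho_{k,r-j}^{m}\eta^m_{r,j}$ for $1\le r\le 2m+1$. (ii) For $k=m+1$: $\sigma_{m+1,0}^{m+1}=\sigma_{m,0}^{m}\rho_{1,0}^{1}+\rho_{m,0}^{m}\sigma_{1,0}^{1}$, $\ \sigma_{m+1,2(m+1)}^{m+1}=\sigma_{m,2m}^{m}\rho_{1,2}^{1}+\rho_{m,2m}^{m}\sigma_{1,2}^{1}$, $\ \sigma_{m+1,r}^{m+1}=\sum_j\left(\sigma_{m,r-j}^{m}\rho_{1,j}^{1}+\rho_{m,r-j}^{m}\sigma_{1,j}^{1}\right)\eta^m_{r,j}$ for $1\le r\le 2m+1$; $\rho_{m+1,0}^{m+1}=\rho_{m,0}^{m}\rho_{1,0}^{1}+\sigma_{m,0}^{m}\sigma_{1,0}^{1}$, $\ \rho_{m+1,2(m+1)}^{m+1}=\rho_{m,2m}^{m}\rho_{1,2}^{1}+\sigma_{m,2m}^{m}\sigma_{1,2}^{1}$,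 $\ \rho_{m+1,r}^{m+1}=\sum_j\left(\rho_{m,r-j}^{m}\rho_{1,j}^{1}+\sigma_{m,r-j}^{m}\sigma_{1,j}^{1}\right)\eta^m_{r,j}$ for $1\le r\le 2m+1$. *)

theory Defs
  imports Complex_Main "Jordan_Normal_Form.Matrix"
begin

text \<open>
  Throughout, \<open>\<alpha>\<close> is the shape parameter and the even lower index \<open>2 m\<close> of the
  mathematical notation \<open>h_{2m,i}\<close>, \<open>H_{2m,i}\<close> is represented by the order \<open>m\<close>.
\<close>

definition hyp_coeff :: "real \<Rightarrow> nat \<Rightarrow> nat \<Rightarrow> real" where
  "hyp_coeff \<alpha> m i =
     1 / sinh (\<alpha> / 2) ^ (2 * m) *
     (\<Sum>r = 0..i div 2. real (m choose (i - r)) * real ((i - r) choose r) *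
        (2 * cosh (\<alpha> / 2)) ^ (i - 2 * r))"

text \<open>Meaningful for \<open>u \<in> {0..\<alpha>}\<close> and \<open>i \<le> 2 * m\<close>.\<close>

definition hyp_B :: "real \<Rightarrow> nat \<Rightarrow> nat \<Rightarrow> real \<Rightarrow> real" where
  "hyp_B \<alpha> m i u =
     hyp_coeff \<alpha> m i * sinh ((\<alpha> - u) / 2) ^ (2 * m - i) * sinh (u / 2) ^ i"

definition elev_weight :: "real \<Rightarrow> nat \<Rightarrow> nat \<Rightarrow> nat \<Rightarrow> real" where
  "elev_weight \<alpha> m r j =
     hyp_coeff \<alpha> m (r - j) * hyp_coeff \<alpha> 1 j / hyp_coeff \<alpha> (m + 1) r"

text \<open>The \<open>j \<in> {0, 1, 2}\<close> with \<open>0 \<le> r - j \<le> 2 m\<close>, the difference being that of the integers.\<close>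

definition elev_range :: "nat \<Rightarrow> nat \<Rightarrow> nat set" where
  "elev_range m r = {j \<in> {0, 1, 2}. j \<le> r \<and> r - j \<le> 2 * m}"

text \<open>
  \<open>hyp_sigma \<alpha> m k r\<close> and \<open>hyp_rho \<alpha> m k r\<close> are the coefficients of \<open>sinh (k u)\<close> and
  \<open>cosh (k u)\<close>, for \<open>m \<ge> 1\<close>, \<open>1 \<le> k \<le> m\<close> and \<open>r \<le> 2 * m\<close>; outside this range
  they are \<open>0\<close> by convention. In the third equation of each function, \<open>m = Suc m'\<close> and the
  recursion steps from order \<open>m\<close> to order \<open>m + 1\<close>.
\<close>

fun hyp_sigma :: "real \<Rightarrow> nat \<Rightarrow> nat \<Rightarrow> nat \<Rightarrow> real"
  and hyp_rho :: "real \<Rightarrow> nat \<Rightarrow> nat \<Rightarrow> nat \<Rightarrow> real"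
where
  "hyp_sigma \<alpha> 0 k r = 0"
| "hyp_sigma \<alpha> (Suc 0) k r =
     (if k = 1 then
        if r = 0 then 0
        else if r = 1 then tanh (\<alpha> / 2)
        else if r = 2 then sinh \<alpha>
        else 0
      else 0)"
| "hyp_sigma \<alpha> (Suc (Suc m')) k r =
     (let m = Suc m' in
      if 1 \<le> k \<and> k \<le> m then
        if r = 0 then hyp_sigma \<alpha> m k 0
        else if r = 2 * (m + 1) then hyp_sigma \<alpha> m k (2 * m)
        else if r \<le> 2 * m + 1 then
          (\<Sum>j\<in>elev_range m r. hyp_sigma \<alpha> m k (r - j) * elev_weight \<alpha> m r j)
        else 0
      else if k = m + 1 then
        if r = 0 then
          hyp_sigma \<alpha> m m 0 * hyp_rho \<alpha> (Suc 0) 1 0 + hyp_rho \<alpha> m m 0 * hyp_sigma \<alpha> (Suc 0) 1 0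
        else if r = 2 * (m + 1) then
          hyp_sigma \<alpha> m m (2 * m) * hyp_rho \<alpha> (Suc 0) 1 2
            + hyp_rho \<alpha> m m (2 * m) * hyp_sigma \<alpha> (Suc 0) 1 2
        else if r \<le> 2 * m + 1 then
          (\<Sum>j\<in>elev_range m r.
             (hyp_sigma \<alpha> m m (r - j) * hyp_rho \<alpha> (Suc 0) 1 j
                + hyp_rho \<alpha> m m (r - j) * hyp_sigma \<alpha> (Suc 0) 1 j) * elev_weight \<alpha> m r j)
        else 0
      else 0)"
| "hyp_rho \<alpha> 0 k r = 0"
| "hyp_rho \<alpha> (Suc 0) k r =
     (if k = 1 then
        if r = 0 then 1
        else if r = 1 then 1
        else if r = 2 then cosh \<alpha>
        else 0
      else 0)"
| "hyp_rho \<alpha> (Suc (Suc m')) k r =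
     (let m = Suc m' in
      if 1 \<le> k \<and> k \<le> m then
        if r = 0 then hyp_rho \<alpha> m k 0
        else if r = 2 * (m + 1) then hyp_rho \<alpha> m k (2 * m)
        else if r \<le> 2 * m + 1 then
          (\<Sum>j\<in>elev_range m r. hyp_rho \<alpha> m k (r - j) * elev_weight \<alpha> m r j)
        else 0
      else if k = m + 1 then
        if r = 0 then
          hyp_rho \<alpha> m m 0 * hyp_rho \<alpha> (Suc 0) 1 0 + hyp_sigma \<alpha> m m 0 * hyp_sigma \<alpha> (Suc 0) 1 0
        else if r = 2 * (m + 1) then
          hyp_rho \<alpha> m m (2 * m) * hyp_rho \<alpha> (Suc 0) 1 2
            + hyp_sigma \<alpha> m m (2 * m) * hyp_sigma \<alpha> (Suc 0) 1 2
        else if r \<le> 2 * m + 1 then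
          (\<Sum>j\<in>elev_range m r.
             (hyp_rho \<alpha> m m (r - j) * hyp_rho \<alpha> (Suc 0) 1 j
                + hyp_sigma \<alpha> m m (r - j) * hyp_sigma \<alpha> (Suc 0) 1 j) * elev_weight \<alpha> m r j)
        else 0
      else 0)"

text \<open>
  Row \<open>0\<close> belongs to the constant function \<open>1\<close>, rows \<open>2 k - 1\<close> and \<open>2 k\<close> to
  \<open>sinh (k u)\<close> and \<open>cosh (k u)\<close> for \<open>1 \<le> k \<le> m\<close>.
\<close>

definition canonical_vec :: "nat \<Rightarrow> real \<Rightarrow> real vec" where
  "canonical_vec m u = vec (2 * m + 1) (\<lambda>i.
     if i = 0 then 1
     else if odd i then sinh (real ((i + 1) div 2) * u)
     else cosh (real (i div 2) * u))"

definition hyp_B_vec :: "real \<Rightarrow> nat \<Rightarrow> real \<Rightarrow> real vec" where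
  "hyp_B_vec \<alpha> m u = vec (2 * m + 1) (\<lambda>r. hyp_B \<alpha> m r u)"

definition basis_transformation :: "real \<Rightarrow> nat \<Rightarrow> real mat" where
  "basis_transformation \<alpha> m = mat (2 * m + 1) (2 * m + 1) (\<lambda>(i, r).
     if i = 0 then 1
     else if odd i then hyp_sigma \<alpha> m ((i + 1) div 2) r
     else hyp_rho \<alpha> m (i div 2) r)"

end

theory Submission
  imports Defs
begin

text \<open>
  Write \<open>H_{m,i}\<close> for \<open>hyp_B \<alpha> m i\<close> and \<open>h_{m,i}\<close> for its coefficient \<open>hyp_coeff \<alpha> m i\<close>.
  Apart from the coefficients, \<open>H_{m,i}\<close> is the monomial \<open>x^{2m-i} y^i\<close> in
  \<open>x = sinh ((\<alpha> - u) / 2)\<close> and \<open>y = sinh (u / 2)\<close>, so \<open>H_{m,i} H_{1,j}\<close> is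
  \<open>h_{m,i} h_{1,j} / h_{m+1,i+j}\<close> times \<open>H_{m+1,i+j}\<close>; the denominator is positive
  (lemma \<open>hyp_coeff_pos\<close>). Consequently the coefficients of a product of
  a function of order \<open>m\<close> and one of order \<open>1\<close> are given by the weighted convolution with the
  weights \<open>elev_weight\<close> (lemma \<open>hyp_B_sum_mult_order_one\<close>).

  The recursion for \<open>hyp_sigma\<close> and \<open>hyp_rho\<close> is exactly this convolution. For \<open>k \<le> m\<close> the second
  factor is \<open>1 = \<Sum>j. H_{1,j}\<close>, which is degree elevation; for \<open>k = m + 1\<close> it is the addition
  theorem applied to \<open>m u + u\<close>. The separate end cases \<open>r = 0\<close> and \<open>r = 2 (m + 1)\<close> fit the pattern
  because a single weight occurs there, and it equals \<open>1\<close>. The rows of \<open>sinh\<close> and \<open>cosh\<close> therefore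
  follow by induction on the order from order \<open>1\<close> (lemma \<open>sinh_cosh_expansion\<close>).

  The constant row holds because \<open>sinh (\<alpha>/2)^{2m} h_{m,i}\<close> are the coefficients of the trinomial
  power \<open>(x\<^sup>2 + 2 cosh (\<alpha>/2) x y + y\<^sup>2)^m\<close>, whose base is the constant \<open>sinh (\<alpha>/2)\<^sup>2\<close>
  (lemma \<open>hyp_B_partition_of_unity\<close>).
\<close>

section \<open>Partition of unity\<close>

text \<open>
  The inner index \<open>r\<close> counts the factors contributing \<open>y\<^sup>2\<close>, and \<open>i - r\<close> those contributing
  \<open>d x y\<close> or \<open>y\<^sup>2\<close>.
\<close>

lemma trinomial_expansion:
  fixes d x y :: real
  shows "(\<Sum>i=0..2*m. (\<Sum>r=0..i div 2. real (m choose (i - r)) * real ((i - r) choose r) *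
            d ^ (i - 2 * r)) * x ^ (2 * m - i) * y ^ i)
         = (x\<^sup>2 + d * x * y + y\<^sup>2) ^ m"
proof -
  define t where "t = (\<lambda>k r. real (m choose k) * real (k choose r) * d ^ (k - r)
                          * x ^ (2 * m - (k + r)) * y ^ (k + r))"
  have inner: "(d * x * y + y\<^sup>2) ^ k * (x\<^sup>2) ^ (m - k) * real (m choose k) = (\<Sum>r=0..k. t k r)"
    if "k \<le> m" for k
  proof -
    have "(d * x * y + y\<^sup>2) ^ k = (\<Sum>r\<le>k. real (k choose r) * (y\<^sup>2) ^ r * (d * x * y) ^ (k - r))"
      by (subst add.commute, subst binomial_ring) simp
    then have "(d * x * y + y\<^sup>2) ^ k * (x\<^sup>2) ^ (m - k) * real (m choose k) =
      (\<Sum>r\<le>k. real (k choose r) * (y\<^sup>2) ^ r * (d * x * y) ^ (k - r) * (x\<^sup>2) ^ (m - k)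
          * real (m choose k))"
      by (simp add: sum_distrib_right)
    also have "\<dots> = (\<Sum>r\<le>k. t k r)"
    proof (rule sum.cong[OF refl])
      fix r assume "r \<in> {..k}"
      then have e: "2 * m - (k + r) = (k - r) + 2 * (m - k)" "k + r = 2 * r + (k - r)"
        using that by auto
      show "real (k choose r) * (y\<^sup>2) ^ r * (d * x * y) ^ (k - r) * (x\<^sup>2) ^ (m - k)
          * real (m choose k) = t k r"
        unfolding t_def e(1) 
        by (subst e(2), simp only: power_add power_mult power_mult_distrib) (simp only: mult_ac)
    qed
    finally show ?thesis by (simp add: atLeast0AtMost)
  qed
  have "(x\<^sup>2 + d * x * y + y\<^sup>2) ^ m = ((d * x * y + y\<^sup>2) + x\<^sup>2) ^ m"
    by (simp add: algebra_simps)
  also have "\<dots> = (\<Sum>k\<le>m. real (m choose k) * (d * x * y + y\<^sup>2) ^ k * (x\<^sup>2) ^ (m - k))"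
    by (subst binomial_ring) simp
  also have "\<dots> = (\<Sum>k\<le>m. \<Sum>r=0..k. t k r)"
    by (rule sum.cong) (simp_all add: inner[symmetric] mult_ac)
  also have "\<dots> = (\<Sum>(k,r)\<in>(SIGMA k:{..m}. {0..k}). t k r)"
    by (simp add: sum.Sigma)
  also have "\<dots> = (\<Sum>(i,r)\<in>(SIGMA i:{0..2*m}. {0..i div 2}). t (i - r) r)"
    \<comment> \<open>The substitution \<open>i = k + r\<close>; the surplus pairs with \<open>i - r > m\<close> have a zero binomial.\<close>
    by (rule sum.reindex_bij_witness_not_neutral[
          where S' = "{}" and T' = "{(i,r). (i,r) \<in> (SIGMA i:{0..2*m}. {0..i div 2}) \<and> i - r > m}"
            and j = "\<lambda>(k,r). (k + r, r)" and i = "\<lambda>(i,r). (i - r, r)"])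
       (auto simp: t_def intro: finite_subset[of _ "SIGMA i:{0..2*m}. {0..i div 2}"])
  also have "\<dots> = (\<Sum>i=0..2*m. \<Sum>r=0..i div 2. t (i - r) r)"
    by (simp add: sum.Sigma)
  also have "\<dots> = (\<Sum>i=0..2*m. (\<Sum>r=0..i div 2. real (m choose (i - r)) * real ((i - r) choose r) *
            d ^ (i - 2 * r)) * x ^ (2 * m - i) * y ^ i)"
  proof (rule sum.cong[OF refl], unfold sum_distrib_right, rule sum.cong[OF refl])
    fix i r :: nat assume "r \<in> {0..i div 2}"
    then have "i - r + r = i" "i - r - r = i - 2 * r" by auto
    then show "t (i - r) r = real (m choose (i - r)) * real ((i - r) choose r) *
            d ^ (i - 2 * r) * x ^ (2 * m - i) * y ^ i"
      by (simp add: t_def)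
  qed
  finally show ?thesis by simp
qed

lemma sinh_half_quadratic:
  fixes \<alpha> u :: real
  shows "sinh ((\<alpha> - u) / 2) ^ 2 + 2 * cosh (\<alpha> / 2) * sinh ((\<alpha> - u) / 2) * sinh (u / 2)
           + sinh (u / 2) ^ 2 = sinh (\<alpha> / 2) ^ 2"
proof -
  have *: "sinh ((\<alpha> - u) / 2) = sinh (\<alpha> / 2) * cosh (u / 2) - cosh (\<alpha> / 2) * sinh (u / 2)"
    by (simp add: diff_divide_distrib sinh_diff)
  have "sinh ((\<alpha> - u) / 2) ^ 2 + 2 * cosh (\<alpha> / 2) * sinh ((\<alpha> - u) / 2) * sinh (u / 2)
           + sinh (u / 2) ^ 2
        = sinh (\<alpha> / 2) ^ 2 * cosh (u / 2) ^ 2 - cosh (\<alpha> / 2) ^ 2 * sinh (u / 2) ^ 2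
           + sinh (u / 2) ^ 2"
    unfolding * by (simp add: power2_eq_square algebra_simps)
  also have "\<dots> = sinh (\<alpha> / 2) ^ 2"
    by (simp add: cosh_square_eq algebra_simps)
  finally show ?thesis .
qed

lemma hyp_B_partition_of_unity:
  assumes "\<alpha> > 0"
  shows "(\<Sum>r=0..2*m. hyp_B \<alpha> m r u) = 1"
proof -
  have "(\<Sum>r=0..2*m. hyp_B \<alpha> m r u) = 1 / sinh (\<alpha> / 2) ^ (2 * m) *
      (sinh ((\<alpha> - u) / 2) ^ 2 + 2 * cosh (\<alpha> / 2) * sinh ((\<alpha> - u) / 2) * sinh (u / 2)
         + sinh (u / 2) ^ 2) ^ m"
    unfolding trinomial_expansion[symmetric] hyp_B_def hyp_coeff_def
    by (simp add: sum_distrib_left mult_ac)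
  also have "\<dots> = 1"
    using assms by (simp add: sinh_half_quadratic power_mult)
  finally show ?thesis .
qed

section \<open>Products with functions of order one\<close>

lemma hyp_coeff_pos:
  assumes "\<alpha> > 0" "i \<le> 2 * m"
  shows "hyp_coeff \<alpha> m i > 0"
proof -
  have "(\<Sum>r = 0..i div 2. real (m choose (i - r)) * real ((i - r) choose r) *
        (2 * cosh (\<alpha> / 2)) ^ (i - 2 * r)) > 0"
    \<comment> \<open>The summand at \<open>r = i - m\<close> (truncated at \<open>0\<close>) has both binomials nonzero.\<close>
    by (rule sum_pos2[where i = "i - m"]) (use assms in auto)
  then show ?thesis
    using assms by (simp add: hyp_coeff_def)
qed

lemma hyp_coeff_first: "hyp_coeff \<alpha> m 0 = 1 / sinh (\<alpha> / 2) ^ (2 * m)"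
  by (simp add: hyp_coeff_def)

lemma hyp_coeff_last: "hyp_coeff \<alpha> m (2 * m) = 1 / sinh (\<alpha> / 2) ^ (2 * m)"
proof -
  have "(\<Sum>r = 0..m. real (m choose (2 * m - r)) * real ((2 * m - r) choose r) *
        (2 * cosh (\<alpha> / 2)) ^ (2 * m - 2 * r))
      = (\<Sum>r = 0..m. if r = m then 1 else 0)"
    by (rule sum.cong) (auto simp: binomial_eq_0)
  then show ?thesis
    by (simp add: hyp_coeff_def)
qed

lemma hyp_coeff_order_one: "hyp_coeff \<alpha> 1 1 = 2 * cosh (\<alpha> / 2) / sinh (\<alpha> / 2) ^ 2"
  by (simp add: hyp_coeff_def)

lemma elev_range_first: "elev_range m 0 = {0}"
  by (auto simp: elev_range_def)

lemma elev_range_last: "elev_range m (2 * (m + 1)) = {2}"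
  by (auto simp: elev_range_def)

lemma elev_weight_first: "\<alpha> > 0 \<Longrightarrow> elev_weight \<alpha> m 0 0 = 1"
  by (simp add: elev_weight_def hyp_coeff_first power_add power2_eq_square)

lemma elev_weight_last:
  assumes "\<alpha> > 0"
  shows "elev_weight \<alpha> m (2 * (m + 1)) 2 = 1"
proof -
  have "2 * (m + 1) - 2 = 2 * m" by simp
  then show ?thesis
    using assms hyp_coeff_last[of \<alpha> "m + 1"] hyp_coeff_last[of \<alpha> m] hyp_coeff_last[of \<alpha> 1]
    by (simp add: elev_weight_def power_add power2_eq_square)
qed

lemma hyp_B_mult_order_one:
  assumes "\<alpha> > 0" "i \<le> 2 * m" "j \<le> 2"
  shows "hyp_B \<alpha> m i u * hyp_B \<alpha> 1 j u
           = elev_weight \<alpha> m (i + j) j * hyp_B \<alpha> (m + 1) (i + j) u"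
proof -
  have "hyp_coeff \<alpha> (m + 1) (i + j) \<noteq> 0"
    using hyp_coeff_pos[of \<alpha> "i + j" "m + 1"] assms by simp
  moreover have "2 * (m + 1) - (i + j) = (2 * m - i) + (2 * 1 - j)"
    using assms by auto
  ultimately show ?thesis
    by (simp add: hyp_B_def elev_weight_def power_add)
qed

lemma hyp_B_sum_mult_order_one:
  assumes "\<alpha> > 0"
  shows "(\<Sum>i=0..2*m. a i * hyp_B \<alpha> m i u) * (\<Sum>j=0..2. b j * hyp_B \<alpha> 1 j u)
    = (\<Sum>r=0..2*(m+1). (\<Sum>j\<in>elev_range m r. a (r - j) * b j * elev_weight \<alpha> m r j)
          * hyp_B \<alpha> (m + 1) r u)"
proof -
  define g where "g = (\<lambda>r j. a (r - j) * b j * elev_weight \<alpha> m r j * hyp_B \<alpha> (m + 1) r u)"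
  have "(\<Sum>i=0..2*m. a i * hyp_B \<alpha> m i u) * (\<Sum>j=0..2. b j * hyp_B \<alpha> 1 j u)
      = (\<Sum>i=0..2*m. \<Sum>j=0..2. a i * b j * (hyp_B \<alpha> m i u * hyp_B \<alpha> 1 j u))"
    unfolding sum_product by (intro sum.cong refl) (simp add: mult_ac)
  also have "\<dots> = (\<Sum>i=0..2*m. \<Sum>j=0..2. g (i + j) j)"
    by (intro sum.cong refl) (simp add: hyp_B_mult_order_one assms g_def del: One_nat_def)
  also have "\<dots> = (\<Sum>(i,j)\<in>{0..2*m} \<times> {0..2}. g (i + j) j)"
    by (simp add: sum.cartesian_product)
  also have "\<dots> = (\<Sum>(r,j)\<in>(SIGMA r:{0..2*(m+1)}. elev_range m r). g r j)"
    by (rule sum.reindex_bij_witness[where j = "\<lambda>(i,j). (i + j, j)" and i = "\<lambda>(r,j). (r - j, j)"])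
       (auto simp: elev_range_def)
  also have "\<dots> = (\<Sum>r=0..2*(m+1). \<Sum>j\<in>elev_range m r. g r j)"
    by (subst sum.Sigma) (auto simp: elev_range_def)
  finally show ?thesis
    by (simp add: g_def sum_distrib_right)
qed

section \<open>Expansions of the hyperbolic functions\<close>

text \<open>
  The left-hand side is the shape shared by all the recursion equations for \<open>hyp_sigma\<close> and
  \<open>hyp_rho\<close>; its end cases are instances of the convolution.
\<close>

lemma elev_sum_cases:
  assumes "\<alpha> > 0" "r \<le> 2 * (m + 1)"
  shows "(if r = 0 then f 0 0
          else if r = 2 * (m + 1) then f (2 * m) 2
          else if r \<le> 2 * m + 1 then (\<Sum>j\<in>elev_range m r. f (r - j) j * elev_weight \<alpha> m r j)
          else 0)
    = (\<Sum>j\<in>elev_range m r. f (r - j) j * elev_weight \<alpha> m r j)"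
proof -
  have "2 * (m + 1) - 2 = 2 * m" by simp
  moreover have "(\<Sum>j\<in>elev_range m (2 * (m + 1)). f (2 * (m + 1) - j) j
                    * elev_weight \<alpha> m (2 * (m + 1)) j) = f (2 * (m + 1) - 2) 2"
    unfolding elev_range_last using elev_weight_last[OF assms(1), of m] by simp
  moreover have "(\<Sum>j\<in>elev_range m 0. f (0 - j) j * elev_weight \<alpha> m 0 j) = f 0 0"
    unfolding elev_range_first using elev_weight_first[OF assms(1), of m] by simp
  ultimately show ?thesis using assms(2) by auto
qed

text \<open>
  The factor \<open>1\<close> is kept because it is the coefficient of the constant function at order \<open>1\<close>:
  the right-hand sides then have the shape of a product with that function.
\<close>

lemma hyp_sigma_rho_elevate:
  assumes "\<alpha> > 0" "1 \<le> m" "1 \<le> k" "k \<le> m" "r \<le> 2 * (m + 1)"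
  shows "hyp_sigma \<alpha> (m + 1) k r
           = (\<Sum>j\<in>elev_range m r. hyp_sigma \<alpha> m k (r - j) * 1 * elev_weight \<alpha> m r j)"
    and "hyp_rho \<alpha> (m + 1) k r
           = (\<Sum>j\<in>elev_range m r. hyp_rho \<alpha> m k (r - j) * 1 * elev_weight \<alpha> m r j)"
proof -
  show "hyp_sigma \<alpha> (m + 1) k r
           = (\<Sum>j\<in>elev_range m r. hyp_sigma \<alpha> m k (r - j) * 1 * elev_weight \<alpha> m r j)"
    by (rule trans[OF _ elev_sum_cases[OF assms(1,5), where f = "\<lambda>i j. hyp_sigma \<alpha> m k i * 1"]])
       (use assms(2-4) in \<open>cases m; simp add: Let_def\<close>)
  show "hyp_rho \<alpha> (m + 1) k r
           = (\<Sum>j\<in>elev_range m r. hyp_rho \<alpha> m k (r - j) * 1 * elev_weight \<alpha> m r j)"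
    by (rule trans[OF _ elev_sum_cases[OF assms(1,5), where f = "\<lambda>i j. hyp_rho \<alpha> m k i * 1"]])
       (use assms(2-4) in \<open>cases m; simp add: Let_def\<close>)
qed

lemma hyp_sigma_rho_top:
  assumes "\<alpha> > 0" "1 \<le> m" "r \<le> 2 * (m + 1)"
  shows "hyp_sigma \<alpha> (m + 1) (m + 1) r
           = (\<Sum>j\<in>elev_range m r. (hyp_sigma \<alpha> m m (r - j) * hyp_rho \<alpha> 1 1 j
                + hyp_rho \<alpha> m m (r - j) * hyp_sigma \<alpha> 1 1 j) * elev_weight \<alpha> m r j)"
    and "hyp_rho \<alpha> (m + 1) (m + 1) r
           = (\<Sum>j\<in>elev_range m r. (hyp_rho \<alpha> m m (r - j) * hyp_rho \<alpha> 1 1 j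
                + hyp_sigma \<alpha> m m (r - j) * hyp_sigma \<alpha> 1 1 j) * elev_weight \<alpha> m r j)"
proof -
  show "hyp_sigma \<alpha> (m + 1) (m + 1) r
           = (\<Sum>j\<in>elev_range m r. (hyp_sigma \<alpha> m m (r - j) * hyp_rho \<alpha> 1 1 j
                + hyp_rho \<alpha> m m (r - j) * hyp_sigma \<alpha> 1 1 j) * elev_weight \<alpha> m r j)"
    by (rule trans[OF _ elev_sum_cases[OF assms(1,3), where f = "\<lambda>i j. hyp_sigma \<alpha> m m i * hyp_rho \<alpha> 1 1 j
                + hyp_rho \<alpha> m m i * hyp_sigma \<alpha> 1 1 j"]])
       (use assms(2) in \<open>cases m; simp add: Let_def\<close>)
  show "hyp_rho \<alpha> (m + 1) (m + 1) r
           = (\<Sum>j\<in>elev_range m r. (hyp_rho \<alpha> m m (r - j) * hyp_rho \<alpha> 1 1 j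
                + hyp_sigma \<alpha> m m (r - j) * hyp_sigma \<alpha> 1 1 j) * elev_weight \<alpha> m r j)"
    by (rule trans[OF _ elev_sum_cases[OF assms(1,3), where f = "\<lambda>i j. hyp_rho \<alpha> m m i * hyp_rho \<alpha> 1 1 j
                + hyp_sigma \<alpha> m m i * hyp_sigma \<alpha> 1 1 j"]])
       (use assms(2) in \<open>cases m; simp add: Let_def\<close>)
qed

lemma sinh_cosh_expansion_order_one:
  assumes "\<alpha> > 0"
  shows "sinh u = (\<Sum>r=0..2. hyp_sigma \<alpha> 1 1 r * hyp_B \<alpha> 1 r u)"
    and "cosh u = (\<Sum>r=0..2. hyp_rho \<alpha> 1 1 r * hyp_B \<alpha> 1 r u)"
proof -
  define s c x y z where "s = sinh (\<alpha> / 2)" and "c = cosh (\<alpha> / 2)"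
    and "x = sinh ((\<alpha> - u) / 2)" and "y = sinh (u / 2)" and "z = cosh (u / 2)"
  note defs = s_def c_def x_def y_def z_def
  have pos: "s > 0" "c > 0" using assms by (simp_all add: defs)
  have x: "x = s * z - c * y"
    by (simp add: defs diff_divide_distrib sinh_diff)
  have u: "sinh u = 2 * y * z" "cosh u = 1 + 2 * y\<^sup>2" "sinh \<alpha> = 2 * s * c" "cosh \<alpha> = 1 + 2 * s\<^sup>2"
    using sinh_double[of "u / 2"] cosh_double[of "u / 2"] sinh_double[of "\<alpha> / 2"]
      cosh_double[of "\<alpha> / 2"] by (simp_all add: defs cosh_square_eq)
  have B2: "hyp_B \<alpha> 1 2 u = y\<^sup>2 / s\<^sup>2"
    using hyp_coeff_last[of \<alpha> 1] by (simp add: hyp_B_def defs)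
  have B1: "hyp_B \<alpha> 1 1 u = 2 * c * x * y / s\<^sup>2"
    using hyp_coeff_order_one[of \<alpha>] by (simp add: hyp_B_def defs)
  have three: "{0..2::nat} = {0, 1, 2}" by auto
  have "(\<Sum>r=0..2. hyp_sigma \<alpha> 1 1 r * hyp_B \<alpha> 1 r u)
      = s / c * hyp_B \<alpha> 1 1 u + 2 * s * c * hyp_B \<alpha> 1 2 u"
    by (simp add: three u(3) tanh_def defs)
  also have "\<dots> = 2 * y * (x + c * y) / s"
    unfolding B1 B2 using pos by (simp add: field_simps power2_eq_square)
  finally show "sinh u = (\<Sum>r=0..2. hyp_sigma \<alpha> 1 1 r * hyp_B \<alpha> 1 r u)"
    using pos by (simp add: x u)
  have "(\<Sum>r=0..2. hyp_rho \<alpha> 1 1 r * hyp_B \<alpha> 1 r u)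
      = (\<Sum>r=0..2. hyp_B \<alpha> 1 r u) + 2 * s\<^sup>2 * hyp_B \<alpha> 1 2 u"
    by (simp add: three u(4) algebra_simps)
  then show "cosh u = (\<Sum>r=0..2. hyp_rho \<alpha> 1 1 r * hyp_B \<alpha> 1 r u)"
    using hyp_B_partition_of_unity[OF assms, of 1 u] pos B2 by (simp add: u)
qed

lemma sinh_cosh_expansion:
  assumes "\<alpha> > 0" "1 \<le> m" "1 \<le> k" "k \<le> m"
  shows "sinh (real k * u) = (\<Sum>r=0..2*m. hyp_sigma \<alpha> m k r * hyp_B \<alpha> m r u) \<and>
         cosh (real k * u) = (\<Sum>r=0..2*m. hyp_rho \<alpha> m k r * hyp_B \<alpha> m r u)"
  using assms(2-4)
proof (induction m arbitrary: k rule: nat_induct_at_least)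
  case base
  then have "k = 1" by simp
  then show ?case
    using sinh_cosh_expansion_order_one[OF assms(1), of u] by simp
next
  case (Suc m)
  let ?S = "\<lambda>k. \<Sum>i=0..2*m. hyp_sigma \<alpha> m k i * hyp_B \<alpha> m i u"
  let ?C = "\<lambda>k. \<Sum>i=0..2*m. hyp_rho \<alpha> m k i * hyp_B \<alpha> m i u"
  let ?S1 = "\<Sum>j=0..2. hyp_sigma \<alpha> 1 1 j * hyp_B \<alpha> 1 j u"
  let ?C1 = "\<Sum>j=0..2. hyp_rho \<alpha> 1 1 j * hyp_B \<alpha> 1 j u"
  let ?one = "\<Sum>j=0..2. 1 * hyp_B \<alpha> 1 j u"
  note conv = hyp_B_sum_mult_order_one[OF assms(1)]
  show ?case
  proof (cases "k \<le> m")
    case True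
    have one: "?one = 1"
      using hyp_B_partition_of_unity[OF assms(1), of 1 u] by simp
    have "sinh (real k * u) = ?S k * ?one" "cosh (real k * u) = ?C k * ?one"
      using Suc.IH[OF Suc.prems(1) True] unfolding one by simp_all
    then show ?thesis
      unfolding conv Suc_eq_plus1
      by (auto intro!: sum.cong simp only: atLeastAtMost_iff
            hyp_sigma_rho_elevate[OF assms(1) Suc.hyps Suc.prems(1) True])
  next
    case False
    then have k: "k = m + 1" using Suc.prems by simp
    have m: "sinh (real m * u) = ?S m" "cosh (real m * u) = ?C m"
      using Suc.IH[of m] Suc.hyps by simp_all
    note one = sinh_cosh_expansion_order_one[OF assms(1), of u]
    have "real k * u = real m * u + u"
      by (simp add: k algebra_simps)
    then have "sinh (real k * u) = ?S m * ?C1 + ?C m * ?S1"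
      "cosh (real k * u) = ?C m * ?C1 + ?S m * ?S1"
      unfolding m[symmetric] one[symmetric] by (simp_all add: sinh_add cosh_add)
    then show ?thesis
      unfolding conv Suc_eq_plus1 k sum.distrib[symmetric] distrib_right[symmetric]
      by (auto intro!: sum.cong simp only: atLeastAtMost_iff
            hyp_sigma_rho_top[OF assms(1) Suc.hyps])
  qed
qed

theorem theorem4p2:
  fixes \<alpha> :: real and n :: nat
  assumes "\<alpha> > 0" and "n \<ge> 1"
  shows "\<forall>u\<in>{0..\<alpha>}.
      canonical_vec (n + 1) u = basis_transformation \<alpha> (n + 1) *\<^sub>v hyp_B_vec \<alpha> (n + 1) u \<and>
      1 = (\<Sum>r = 0..2 * (n + 1). hyp_B \<alpha> (n + 1) r u) \<and>
      (\<forall>k\<in>{1..n + 1}.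
         sinh (real k * u) = (\<Sum>r = 0..2 * (n + 1). hyp_sigma \<alpha> (n + 1) k r * hyp_B \<alpha> (n + 1) r u) \<and>
         cosh (real k * u) = (\<Sum>r = 0..2 * (n + 1). hyp_rho \<alpha> (n + 1) k r * hyp_B \<alpha> (n + 1) r u))"
proof (intro ballI conjI)
  fix u assume "u \<in> {0..\<alpha>}"
  define m where "m = n + 1"
  have unity: "1 = (\<Sum>r=0..2*m. hyp_B \<alpha> m r u)"
    using hyp_B_partition_of_unity[OF assms(1)] by simp
  have expansion: "sinh (real k * u) = (\<Sum>r=0..2*m. hyp_sigma \<alpha> m k r * hyp_B \<alpha> m r u)"
    "cosh (real k * u) = (\<Sum>r=0..2*m. hyp_rho \<alpha> m k r * hyp_B \<alpha> m r u)"
    if "1 \<le> k" "k \<le> m" for k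
    using sinh_cosh_expansion[OF assms(1) _ that] that by auto
  show "1 = (\<Sum>r = 0..2 * (n + 1). hyp_B \<alpha> (n + 1) r u)"
    using unity by (simp add: m_def)
  show "sinh (real k * u) = (\<Sum>r = 0..2 * (n + 1). hyp_sigma \<alpha> (n + 1) k r * hyp_B \<alpha> (n + 1) r u)"
    "cosh (real k * u) = (\<Sum>r = 0..2 * (n + 1). hyp_rho \<alpha> (n + 1) k r * hyp_B \<alpha> (n + 1) r u)"
    if "k \<in> {1..n + 1}" for k
    using expansion[of k] that unfolding m_def by auto
  have "canonical_vec m u = basis_transformation \<alpha> m *\<^sub>v hyp_B_vec \<alpha> m u"
  proof (rule eq_vecI)
    fix i assume "i < dim_vec (basis_transformation \<alpha> m *\<^sub>v hyp_B_vec \<alpha> m u)"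
    then have i: "i < 2 * m + 1" by (simp add: basis_transformation_def)
    have range: "{0..<2 * m + 1} = {0..2 * m}" by auto
    have entry: "(basis_transformation \<alpha> m *\<^sub>v hyp_B_vec \<alpha> m u) $ i
        = (\<Sum>r=0..2*m. (if i = 0 then 1 else if odd i then hyp_sigma \<alpha> m ((i + 1) div 2) r
             else hyp_rho \<alpha> m (i div 2) r) * hyp_B \<alpha> m r u)"
      using i unfolding range[symmetric]
      by (simp add: basis_transformation_def hyp_B_vec_def scalar_prod_def)
    consider "i = 0" | "odd i" | "i \<noteq> 0" "even i" by blast
    then show "canonical_vec m u $ i = (basis_transformation \<alpha> m *\<^sub>v hyp_B_vec \<alpha> m u) $ i"
    proof cases
      case 1
      then show ?thesis
        unfolding entry using unity by (simp add: canonical_vec_def)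
    next
      case 2
      then have "1 \<le> (i + 1) div 2" "(i + 1) div 2 \<le> m" "i \<noteq> 0"
        using i by (auto elim!: oddE)
      then show ?thesis
        unfolding entry using expansion(1)[of "(i + 1) div 2"] 2 i by (simp add: canonical_vec_def)
    next
      case 3
      then have "1 \<le> i div 2" "i div 2 \<le> m"
        using i by (auto elim!: evenE)
      then show ?thesis
        unfolding entry using expansion(2)[of "i div 2"] 3 i by (simp add: canonical_vec_def)
    qed
  qed (simp add: canonical_vec_def basis_transformation_def)
  then show "canonical_vec (n + 1) u = basis_transformation \<alpha> (n + 1) *\<^sub>v hyp_B_vec \<alpha> (n + 1) u"
    by (simp add: m_def)
qed

end
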